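(* Let $\mathbf{M}=(M;\leq,0,1)$ be a non-trivial complete lattice, let $S$ be a non-empty set, and let $\mathbf{B}$ be a bounded subposet of $\mathbf{M}^{S}$. Let $(\wp(S\times S);\subseteq)$ be the poset of all relations on $S$, and let $\mathrm{Map}_1(\mathbf{B},\mathbf{M}^S)$ be the set of all order-preserving mappings $T\colon B\to M^S$ with $T(1)=1$, ordered by $T_1\sqsubseteq T_2$ if and only if $T_2(b)\leq T_1(b)$ for all $b\in B$. Define $\varphi(R)=T_R$ for $R\in\wp(S\times S)$ and $\psi(T)=R_T$ for $T\in \mathrm{Map}_1(\mathbf{B},\mathbf{M}^S)$. Then $(\varphi,\psi)$ is a Galois connection between $(\wp(S\times S);\subseteq)$ and $(\mathrm{Map}_1(\mathbf{B},\mathbf{M}^S);\sqsubseteq)$, i.e., $\varphi$ and $\psi$ are maps between these posets and for all $R$ and $T$: $\varphi(R)\sqsubseteq T$ if and only if $R\subseteq\psi(T)$.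
   Context: Non-trivial means $0\neq 1$. $\mathbf{M}^S$ is ordered componentwise; a bounded subposet of $\mathbf{M}^S$ is a subset containing the constant tuples $0$ and $1$ with the inherited order. For $s\in S$ and $m\in M^S$, $s(m)$ denotes the $s$-th component of $m$. For $R\subseteq S\times S$ (writing $sRt$ for $(s,t)\in R$), $T_R\colon B\to M^S$ is defined by $T_R(b)(s)=\bigwedge_M\{t(b)\mid sRt\}$ (the empty meet being $1$). For $T\colon B\to M^S$, $R_T=\{(s,t)\in S\times S\mid \forall b\in B:\ s(T(b))\leq t(b)\}$. *)

theory Defs
  imports "HOL-Algebra.Galois_Connection" "HOL-Library.FuncSet"
begin

text \<open>
  Maps with domain a set are represented by extensional functions, so that equality of
  HOL functions is equality of maps and the posets of maps below are antisymmetric.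
  The component of \<open>m\<close> at \<open>s\<close>, written \<open>s(m)\<close> in the literature, is \<open>m s\<close>.
\<close>

definition power_poset :: "('m, 'c) gorder_scheme \<Rightarrow> 's set \<Rightarrow> ('s \<Rightarrow> 'm) gorder"
  where "power_poset M S =
    \<lparr>carrier = S \<rightarrow>\<^sub>E carrier M, eq = (=),
     le = (\<lambda>m n. \<forall>s\<in>S. m s \<sqsubseteq>\<^bsub>M\<^esub> n s)\<rparr>"

definition const_zero :: "('m, 'c) gorder_scheme \<Rightarrow> 's set \<Rightarrow> 's \<Rightarrow> 'm"
  where "const_zero M S = (\<lambda>s\<in>S. \<bottom>\<^bsub>M\<^esub>)"

definition const_one :: "('m, 'c) gorder_scheme \<Rightarrow> 's set \<Rightarrow> 's \<Rightarrow> 'm"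
  where "const_one M S = (\<lambda>s\<in>S. \<top>\<^bsub>M\<^esub>)"

definition bounded_subposet :: "('m, 'c) gorder_scheme \<Rightarrow> 's set \<Rightarrow> ('s \<Rightarrow> 'm) set \<Rightarrow> bool"
  where "bounded_subposet M S B \<longleftrightarrow>
    B \<subseteq> carrier (power_poset M S) \<and> const_zero M S \<in> B \<and> const_one M S \<in> B"

definition relation_poset :: "'s set \<Rightarrow> ('s \<times> 's) set gorder"
  where "relation_poset S = \<lparr>carrier = Pow (S \<times> S), eq = (=), le = (\<subseteq>)\<rparr>"

text \<open>Note that the order on maps is the reverse of the pointwise one.\<close>

definition map1_poset ::
    "('m, 'c) gorder_scheme \<Rightarrow> 's set \<Rightarrow> ('s \<Rightarrow> 'm) set \<Rightarrow> (('s \<Rightarrow> 'm) \<Rightarrow> 's \<Rightarrow> 'm) gorder"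
  where "map1_poset M S B =
    \<lparr>carrier = {T \<in> B \<rightarrow>\<^sub>E carrier (power_poset M S).
        isotone ((power_poset M S)\<lparr>carrier := B\<rparr>) (power_poset M S) T \<and>
        T (const_one M S) = const_one M S},
     eq = (=),
     le = (\<lambda>T\<^sub>1 T\<^sub>2. \<forall>b\<in>B. T\<^sub>2 b \<sqsubseteq>\<^bsub>power_poset M S\<^esub> T\<^sub>1 b)\<rparr>"

definition map_of_rel ::
    "('m, 'c) gorder_scheme \<Rightarrow> 's set \<Rightarrow> ('s \<Rightarrow> 'm) set \<Rightarrow> ('s \<times> 's) set \<Rightarrow> ('s \<Rightarrow> 'm) \<Rightarrow> 's \<Rightarrow> 'm"
  where "map_of_rel M S B R = (\<lambda>b\<in>B. \<lambda>s\<in>S. \<Sqinter>\<^bsub>M\<^esub> {b t | t. t \<in> S \<and> (s, t) \<in> R})"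

definition rel_of_map ::
    "('m, 'c) gorder_scheme \<Rightarrow> 's set \<Rightarrow> ('s \<Rightarrow> 'm) set \<Rightarrow> (('s \<Rightarrow> 'm) \<Rightarrow> 's \<Rightarrow> 'm) \<Rightarrow> ('s \<times> 's) set"
  where "rel_of_map M S B T = {(s, t) \<in> S \<times> S. \<forall>b\<in>B. T b s \<sqsubseteq>\<^bsub>M\<^esub> b t}"

end

theory Submission
  imports Defs
begin

text \<open>Both sides of the adjunction unfold to one condition: \<open>T b s\<close> lies below
  \<open>b t\<close> for all \<open>b\<close> in \<open>B\<close> and all \<open>(s, t)\<close> in
  \<open>R\<close>. For \<open>R \<subseteq> rel_of_map M S B T\<close> this is the definition of
  the induced relation. For the other side, the reversed order on maps says that
  \<open>T b s\<close> lies below the meet of the values \<open>b t\<close> over the successors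
  \<open>t\<close> of \<open>s\<close>, and an element is below a meet iff it is below every member
  (\<open>le_inf_iff\<close>). \<open>map_of_rel_le_iff\<close> joins the two readings. What remains
  is that the structures are partial orders and that the map built from a relation is isotone and
  preserves the constant one (\<open>map_of_rel_closed\<close>).\<close>

text \<open>Orders in HOL-Algebra carry their own equivalence \<open>eq\<close>. When it is true
  equality, the congruence conditions are trivial and the three classical axioms suffice.\<close>

lemma partial_orderI_eq:
  assumes "eq L = (=)"
    and "\<And>x. x \<in> carrier L \<Longrightarrow> x \<sqsubseteq>\<^bsub>L\<^esub> x"
    and "\<And>x y. \<lbrakk>x \<in> carrier L; y \<in> carrier L; x \<sqsubseteq>\<^bsub>L\<^esub> y; y \<sqsubseteq>\<^bsub>L\<^esub> x\<rbrakk> \<Longrightarrow> x = y"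
    and "\<And>x y z. \<lbrakk>x \<in> carrier L; y \<in> carrier L; z \<in> carrier L; x \<sqsubseteq>\<^bsub>L\<^esub> y; y \<sqsubseteq>\<^bsub>L\<^esub> z\<rbrakk>
      \<Longrightarrow> x \<sqsubseteq>\<^bsub>L\<^esub> z"
  shows "partial_order L"
proof unfold_locales
  show "x .=\<^bsub>L\<^esub> y" if "x \<sqsubseteq>\<^bsub>L\<^esub> y" "y \<sqsubseteq>\<^bsub>L\<^esub> x" "x \<in> carrier L" "y \<in> carrier L" for x y
    using assms(3)[of x y] that by (simp add: assms(1))
  show "x \<sqsubseteq>\<^bsub>L\<^esub> z"
    if "x \<sqsubseteq>\<^bsub>L\<^esub> y" "y \<sqsubseteq>\<^bsub>L\<^esub> z" "x \<in> carrier L" "y \<in> carrier L" "z \<in> carrier L" for x y z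
    using assms(4)[of x y z] that by simp
qed (simp_all add: assms(1,2))

lemma partial_order_relation_poset: "partial_order (relation_poset S)"
  by (rule partial_orderI_eq) (auto simp: relation_poset_def)

lemma power_poset_simps:
  "carrier (power_poset M S) = S \<rightarrow>\<^sub>E carrier M"
  "m \<sqsubseteq>\<^bsub>power_poset M S\<^esub> n \<longleftrightarrow> (\<forall>s\<in>S. m s \<sqsubseteq>\<^bsub>M\<^esub> n s)"
  by (simp_all add: power_poset_def)

text \<open>Antisymmetry relies on tuples being extensional: agreement on \<open>S\<close> is then
  equality of functions.\<close>

lemma partial_order_power_poset:
  assumes "partial_order M"
  shows "partial_order (power_poset M S)"
proof -
  interpret partial_order M by fact
  show ?thesis
  proof (rule partial_orderI_eq)
    show "eq (power_poset M S) = (=)"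
      by (simp add: power_poset_def)
  next
    fix x y
    assume "x \<in> carrier (power_poset M S)" "y \<in> carrier (power_poset M S)"
      and "x \<sqsubseteq>\<^bsub>power_poset M S\<^esub> y" "y \<sqsubseteq>\<^bsub>power_poset M S\<^esub> x"
    then show "x = y"
      unfolding power_poset_simps by (meson PiE_ext PiE_mem le_antisym)
  next
    fix x y z
    assume "x \<in> carrier (power_poset M S)" "y \<in> carrier (power_poset M S)"
      and "z \<in> carrier (power_poset M S)"
      and "x \<sqsubseteq>\<^bsub>power_poset M S\<^esub> y" "y \<sqsubseteq>\<^bsub>power_poset M S\<^esub> z"
    then show "x \<sqsubseteq>\<^bsub>power_poset M S\<^esub> z"
      unfolding power_poset_simps by (meson PiE_mem le_trans)
  qed (auto simp: power_poset_simps dest: PiE_mem)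
qed

lemma map1_poset_simps:
  "T \<in> carrier (map1_poset M S B) \<longleftrightarrow> T \<in> B \<rightarrow>\<^sub>E carrier (power_poset M S) \<and>
     isotone ((power_poset M S)\<lparr>carrier := B\<rparr>) (power_poset M S) T \<and>
     T (const_one M S) = const_one M S"
  "T\<^sub>1 \<sqsubseteq>\<^bsub>map1_poset M S B\<^esub> T\<^sub>2 \<longleftrightarrow> (\<forall>b\<in>B. T\<^sub>2 b \<sqsubseteq>\<^bsub>power_poset M S\<^esub> T\<^sub>1 b)"
  by (simp_all add: map1_poset_def)

text \<open>The axioms are inherited pointwise from the power poset, with the order reversed;
  extensionality on \<open>B\<close> gives antisymmetry.\<close>

lemma partial_order_map1_poset:
  assumes "partial_order M"
  shows "partial_order (map1_poset M S B)"
proof -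
  interpret P: partial_order "power_poset M S"
    by (rule partial_order_power_poset) fact
  show ?thesis
  proof (rule partial_orderI_eq)
    show "eq (map1_poset M S B) = (=)"
      by (simp add: map1_poset_def)
  next
    fix T U
    assume "T \<in> carrier (map1_poset M S B)" "U \<in> carrier (map1_poset M S B)"
      and "T \<sqsubseteq>\<^bsub>map1_poset M S B\<^esub> U" "U \<sqsubseteq>\<^bsub>map1_poset M S B\<^esub> T"
    then have T: "T \<in> B \<rightarrow>\<^sub>E carrier (power_poset M S)"
      and U: "U \<in> B \<rightarrow>\<^sub>E carrier (power_poset M S)"
      and le: "\<And>b. b \<in> B \<Longrightarrow> T b \<sqsubseteq>\<^bsub>power_poset M S\<^esub> U b"
        "\<And>b. b \<in> B \<Longrightarrow> U b \<sqsubseteq>\<^bsub>power_poset M S\<^esub> T b"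
      by (simp_all add: map1_poset_simps)
    show "T = U"
    proof (rule PiE_ext[OF T U])
      fix b
      assume "b \<in> B"
      then show "T b = U b"
        using P.le_antisym[OF le] PiE_mem[OF T] PiE_mem[OF U] by blast
    qed
  next
    fix T U V
    assume "T \<in> carrier (map1_poset M S B)" "U \<in> carrier (map1_poset M S B)"
      and "V \<in> carrier (map1_poset M S B)"
      and "T \<sqsubseteq>\<^bsub>map1_poset M S B\<^esub> U" "U \<sqsubseteq>\<^bsub>map1_poset M S B\<^esub> V"
    then have "T b \<in> carrier (power_poset M S)" "U b \<in> carrier (power_poset M S)"
        "V b \<in> carrier (power_poset M S)"
        "U b \<sqsubseteq>\<^bsub>power_poset M S\<^esub> T b" "V b \<sqsubseteq>\<^bsub>power_poset M S\<^esub> U b"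
      if "b \<in> B" for b
      using that unfolding map1_poset_simps by (blast dest: PiE_mem)+
    then show "T \<sqsubseteq>\<^bsub>map1_poset M S B\<^esub> V"
      unfolding map1_poset_simps(2) by (fast intro: P.le_trans)
  next
    fix T
    assume "T \<in> carrier (map1_poset M S B)"
    then show "T \<sqsubseteq>\<^bsub>map1_poset M S B\<^esub> T"
      unfolding map1_poset_simps by (blast dest: PiE_mem)
  qed
qed

context complete_lattice
begin

text \<open>The universal property of the meet, valid also for empty \<open>A\<close>, where the
  meet is the top element.\<close>

lemma le_inf_iff:
  assumes "A \<subseteq> carrier L" "z \<in> carrier L"
  shows "z \<sqsubseteq> \<Sqinter>A \<longleftrightarrow> (\<forall>x\<in>A. z \<sqsubseteq> x)"
proof
  assume "z \<sqsubseteq> \<Sqinter>A"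
  then show "\<forall>x\<in>A. z \<sqsubseteq> x"
    using assms le_trans[OF _ inf_lower[OF assms(1)]] by auto
qed (simp add: inf_greatest[OF assms])

text \<open>Meets are monotone in their members, and a meet of copies of the top, or of nothing, is
  the top. The condition \<open>t \<in> S\<close> inside the meet keeps all members in the carrier,
  whatever \<open>R\<close> is.\<close>

lemma map_of_rel_closed:
  assumes B: "bounded_subposet L S B"
  shows "map_of_rel L S B R \<in> carrier (map1_poset L S B)"
proof -
  let ?P = "power_poset L S" and ?T = "map_of_rel L S B R"
  let ?A = "\<lambda>b s. {b t | t. t \<in> S \<and> (s, t) \<in> R}"
  interpret P: partial_order ?P
    by (rule partial_order_power_poset) (rule partial_order_axioms)
  have B_sub: "B \<subseteq> carrier ?P" and one: "const_one L S \<in> B"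
    using B by (auto simp: bounded_subposet_def)
  have A: "?A b s \<subseteq> carrier L" if "b \<in> B" for b s
    using that B_sub by (auto simp: power_poset_simps dest: PiE_mem)
  have T: "?T b s = \<Sqinter>(?A b s)" if "b \<in> B" "s \<in> S" for b s
    using that by (simp add: map_of_rel_def)
  have "?T \<in> B \<rightarrow>\<^sub>E carrier ?P"
    using A by (auto simp: map_of_rel_def power_poset_simps intro!: inf_closed)
  moreover have "isotone (?P\<lparr>carrier := B\<rparr>) ?P ?T"
  proof (rule isotoneI)
    \<comment> \<open>\<open>isotone\<close> includes that source and target are weak partial
      orders; \<open>B\<close> inherits this from the full power.\<close>
    show "weak_partial_order (?P\<lparr>carrier := B\<rparr>)"
      by (rule weak_partial_order_subset[OF P.weak_partial_order_axioms B_sub])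
    show "weak_partial_order ?P"
      by (rule P.weak_partial_order_axioms)
  next
    fix b c
    assume "b \<in> carrier (?P\<lparr>carrier := B\<rparr>)" "c \<in> carrier (?P\<lparr>carrier := B\<rparr>)"
      and "b \<sqsubseteq>\<^bsub>?P\<lparr>carrier := B\<rparr>\<^esub> c"
    then have b: "b \<in> B" and c: "c \<in> B" and le: "\<forall>s\<in>S. b s \<sqsubseteq> c s"
      by (simp_all add: power_poset_simps)
    \<comment> \<open>The meet for \<open>b\<close> is compared with each member of the meet for
      \<open>c\<close> through the member \<open>b t\<close> at the same index.\<close>
    have "\<Sqinter>(?A b s) \<sqsubseteq> c t" if "t \<in> S" "(s, t) \<in> R" for s t
    proof (rule le_trans)
      show "\<Sqinter>(?A b s) \<sqsubseteq> b t"
        by (rule inf_lower[OF A[OF b]]) (use that in auto)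
      show "b t \<sqsubseteq> c t"
        using le that by blast
      show "\<Sqinter>(?A b s) \<in> carrier L"
        by (rule inf_closed[OF A[OF b]])
      show "b t \<in> carrier L" "c t \<in> carrier L"
        using b c B_sub that by (auto simp: power_poset_simps dest: PiE_mem)
    qed
    then show "?T b \<sqsubseteq>\<^bsub>?P\<^esub> ?T c"
      using inf_closed[OF A[OF b]] A[OF c]
      by (auto simp: power_poset_simps T b c le_inf_iff)
  qed
  moreover have "?T (const_one L S) = const_one L S"
  proof (rule ext)
    fix s
    show "?T (const_one L S) s = const_one L S s"
    \<comment> \<open>Outside \<open>S\<close> both tuples take the value \<open>undefined\<close>,
      so only components in \<open>S\<close> carry content.\<close>
    proof (cases "s \<in> S")
      case True
      \<comment> \<open>Every member of this set is the top, so the top is a lower bound of it,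
        vacuously so if \<open>s\<close> has no successor.\<close>
      have "\<top> \<sqsubseteq> \<Sqinter>(?A (const_one L S) s)"
        using A[OF one] by (auto simp: le_inf_iff const_one_def)
      then show ?thesis
        using True T[OF one True] inf_closed[OF A[OF one, of s]]
        by (simp add: const_one_def le_antisym)
    qed (use one in \<open>simp add: map_of_rel_def const_one_def\<close>)
  qed
  ultimately show ?thesis
    by (simp add: map1_poset_simps)
qed

lemma map_of_rel_le_iff:
  assumes B: "bounded_subposet L S B" and R: "R \<subseteq> S \<times> S"
    and T: "T \<in> carrier (map1_poset L S B)"
  shows "map_of_rel L S B R \<sqsubseteq>\<^bsub>map1_poset L S B\<^esub> T \<longleftrightarrow> R \<subseteq> rel_of_map L S B T"
proof -
  have "T b s \<sqsubseteq> \<Sqinter>{b t | t. t \<in> S \<and> (s, t) \<in> R} \<longleftrightarrow>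
      (\<forall>t\<in>S. (s, t) \<in> R \<longrightarrow> T b s \<sqsubseteq> b t)" if "b \<in> B" "s \<in> S" for b s
  proof -
    have "{b t | t. t \<in> S \<and> (s, t) \<in> R} \<subseteq> carrier L"
      using that B by (auto simp: bounded_subposet_def power_poset_simps dest: PiE_mem)
    moreover have "T b s \<in> carrier L"
    proof -
      have "T \<in> B \<rightarrow>\<^sub>E (S \<rightarrow>\<^sub>E carrier L)"
        using T by (simp add: map1_poset_simps power_poset_simps)
      from PiE_mem[OF PiE_mem[OF this that(1)] that(2)] show ?thesis .
    qed
    ultimately show ?thesis
      by (auto simp: le_inf_iff)
  qed
  \<comment> \<open>The reversed order puts the meet on the larger side, where its universal
    property applies.\<close>
  then have "map_of_rel L S B R \<sqsubseteq>\<^bsub>map1_poset L S B\<^esub> T \<longleftrightarrow>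
      (\<forall>b\<in>B. \<forall>s\<in>S. \<forall>t\<in>S. (s, t) \<in> R \<longrightarrow> T b s \<sqsubseteq> b t)"
    by (simp add: map1_poset_simps power_poset_simps map_of_rel_def)
  \<comment> \<open>Since \<open>R\<close> lies in \<open>S \<times> S\<close>, quantifying over
    \<open>s\<close> and \<open>t\<close> in \<open>S\<close> reaches every pair of
    \<open>R\<close>.\<close>
  also have "\<dots> \<longleftrightarrow> R \<subseteq> rel_of_map L S B T"
    using R by (auto simp: rel_of_map_def)
  finally show ?thesis .
qed

end

theorem theorem2p2:
  fixes M :: "'m gorder" and S :: "'s set" and B :: "('s \<Rightarrow> 'm) set"
  assumes "complete_lattice M"
    and "\<bottom>\<^bsub>M\<^esub> \<noteq> \<top>\<^bsub>M\<^esub>"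
    and "S \<noteq> {}"
    and "bounded_subposet M S B"
  shows "galois_connection
    \<lparr>orderA = relation_poset S, orderB = map1_poset M S B,
     lower = map_of_rel M S B, upper = rel_of_map M S B\<rparr>"
proof -
  interpret complete_lattice M by fact
  show ?thesis
  \<comment> \<open>Unfolding the locales leaves the two partial orders, the closure of both maps,
    and the adjunction itself.\<close>
  proof (intro galois_connection.intro connection.intro galois_connection_axioms.intro,
      simp_all only: galcon.simps)
    show "partial_order (relation_poset S)"
      by (rule partial_order_relation_poset)
    show "partial_order (map1_poset M S B)"
      by (rule partial_order_map1_poset) (rule partial_order_axioms)
    show "map_of_rel M S B \<in> carrier (relation_poset S) \<rightarrow> carrier (map1_poset M S B)"
      using map_of_rel_closed[OF assms(4)] by blast
    show "rel_of_map M S B \<in> carrier (map1_poset M S B) \<rightarrow> carrier (relation_poset S)"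
      by (auto simp: relation_poset_def rel_of_map_def)
  next
    fix R T
    assume "R \<in> carrier (relation_poset S)" "T \<in> carrier (map1_poset M S B)"
    then show "map_of_rel M S B R \<sqsubseteq>\<^bsub>map1_poset M S B\<^esub> T \<longleftrightarrow>
        R \<sqsubseteq>\<^bsub>relation_poset S\<^esub> rel_of_map M S B T"
      using map_of_rel_le_iff[OF assms(4)] by (simp add: relation_poset_def)
  qed
qed

end
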